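(* Let $A,B$ be positive semidefinite $n\times n$ complex matrices, $X$ an $n\times n$ complex matrix, $0\leq\nu\leq 1$ and $N\in\mathbb{N}$ with $N\geq 2$. Then $$\|A^{\nu}XB^{1-\nu}\|_2^2+s_1(\nu)^2\|AX-XB\|_2^2+\sum_{j=2}^{N}s_j(\nu)\left\|A^{\frac{k_j(\nu)}{2^{j-1}}}XB^{1-\frac{k_j(\nu)}{2^{j-1}}}-A^{\frac{k_j(\nu)+1}{2^{j-1}}}XB^{1-\frac{k_j(\nu)+1}{2^{j-1}}}\right\|_2^2\leq\|\nu AX+(1-\nu)XB\|_2^2.$$
   Context: $\|\cdot\|_2$ is the Hilbert-Schmidt (Frobenius) norm. $[x]$ denotes the greatest integer $\le x$. For $\nu\in[0,1]$ and $j\geq 1$ put $k_j(\nu)=[2^{j-1}\nu]$, $r_j(\nu)=[2^{j}\nu]$ and $s_j(\nu)=(-1)^{r_j(\nu)}2^{j-1}\nu+(-1)^{r_j(\nu)+1}\left[\frac{r_j(\nu)+1}{2}\right]$. Powers of positive semidefinite matrices are taken by functional calculus, with $A^0=I$; a summand whose coefficient $s_j(\nu)$ is $0$ is read as $0$ (this matters only for $\nu=1$, where a negative power of $B$ would formally appear). *)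

theory Defs
  imports "Jordan_Normal_Form.Schur_Decomposition" Complex_Main
begin

definition hs_norm :: "complex mat \<Rightarrow> real" where
  "hs_norm A = sqrt (\<Sum>i<dim_row A. \<Sum>j<dim_col A. (cmod (A $$ (i, j)))\<^sup>2)"

definition psd_mat :: "nat \<Rightarrow> complex mat \<Rightarrow> bool" where
  "psd_mat n A \<longleftrightarrow> A \<in> carrier_mat n n \<and> mat_adjoint A = A \<and>
     (\<forall>v \<in> carrier_vec n. 0 \<le> Re ((A *\<^sub>v v) \<bullet>c v))"

text \<open>A spectral decomposition \<open>A = U D U\<^sup>*\<close> with \<open>U\<close> unitary and \<open>D\<close> real diagonal;
  it exists exactly for Hermitian \<open>A\<close>.\<close>

definition spectral_dec :: "nat \<Rightarrow> complex mat \<Rightarrow> complex mat \<Rightarrow> (nat \<Rightarrow> real) \<Rightarrow> bool" where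
  "spectral_dec n A U d \<longleftrightarrow> U \<in> carrier_mat n n \<and>
     mat_adjoint U * U = 1\<^sub>m n \<and> U * mat_adjoint U = 1\<^sub>m n \<and>
     A = U * mat_diag n (\<lambda>i. complex_of_real (d i)) * mat_adjoint U"

text \<open>Functional calculus for Hermitian matrices: \<open>f(U D U\<^sup>*) = U f(D) U\<^sup>*\<close>. The result does not
  depend on the decomposition, see \<open>mat_fun_eqI\<close> below.\<close>

definition mat_fun :: "(real \<Rightarrow> real) \<Rightarrow> complex mat \<Rightarrow> complex mat" where
  "mat_fun f A = (THE C. \<exists>U d. spectral_dec (dim_row A) A U d \<and>
     C = U * mat_diag (dim_row A) (\<lambda>i. complex_of_real (f (d i))) * mat_adjoint U)"

text \<open>In Isabelle \<open>0 powr 0 = 0\<close>, so the convention \<open>A\<^sup>0 = I\<close> has to be built in.\<close>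

definition mat_powr :: "complex mat \<Rightarrow> real \<Rightarrow> complex mat" where
  "mat_powr A t = mat_fun (\<lambda>x. if t = 0 then 1 else x powr t) A"

definition k_seq :: "nat \<Rightarrow> real \<Rightarrow> int" where
  "k_seq j \<nu> = \<lfloor>2 ^ (j - 1) * \<nu>\<rfloor>"

definition r_seq :: "nat \<Rightarrow> real \<Rightarrow> int" where
  "r_seq j \<nu> = \<lfloor>2 ^ j * \<nu>\<rfloor>"

definition s_seq :: "nat \<Rightarrow> real \<Rightarrow> real" where
  "s_seq j \<nu> = (- 1) powi r_seq j \<nu> * 2 ^ (j - 1) * \<nu>
     + (- 1) powi (r_seq j \<nu> + 1) * of_int \<lfloor>(of_int (r_seq j \<nu>) + 1) / 2 :: real\<rfloor>"

lemma mat_adjoint_carrier: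
  assumes "U \<in> carrier_mat n m"
  shows "mat_adjoint U \<in> carrier_mat m n"
  using assms unfolding mat_adjoint_def by auto

lemma mat_diag_intertwine:
  assumes W: "W \<in> carrier_mat n n"
    and eq: "mat_diag n (\<lambda>i. complex_of_real (e i)) * W = W * mat_diag n (\<lambda>i. complex_of_real (d i))"
  shows "mat_diag n (\<lambda>i. complex_of_real (f (e i))) * W = W * mat_diag n (\<lambda>i. complex_of_real (f (d i)))"
proof (rule eq_matI)
  fix i j
  assume "i < dim_row (W * mat_diag n (\<lambda>i. complex_of_real (f (d i))))"
    and "j < dim_col (W * mat_diag n (\<lambda>i. complex_of_real (f (d i))))"
  hence ij: "i < n" "j < n" using W by (auto simp: mat_diag_def)
  have "(mat_diag n (\<lambda>i. complex_of_real (e i)) * W) $$ (i, j)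
      = (W * mat_diag n (\<lambda>i. complex_of_real (d i))) $$ (i, j)" using eq by simp
  hence "complex_of_real (e i) * W $$ (i, j) = W $$ (i, j) * complex_of_real (d j)"
    using ij by (simp add: mat_diag_mult_left[OF W] mat_diag_mult_right[OF W])
  hence "e i = d j \<or> W $$ (i, j) = 0" by (auto simp: mult.commute)
  thus "(mat_diag n (\<lambda>i. complex_of_real (f (e i))) * W) $$ (i, j)
      = (W * mat_diag n (\<lambda>i. complex_of_real (f (d i)))) $$ (i, j)"
    using ij by (auto simp: mat_diag_mult_left[OF W] mat_diag_mult_right[OF W])
qed (use W in \<open>auto simp: mat_diag_def\<close>)

lemma spectral_dec_unique:
  assumes U: "spectral_dec n A U d" and V: "spectral_dec n A V e"
  shows "U * mat_diag n (\<lambda>i. complex_of_real (f (d i))) * mat_adjoint U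
       = V * mat_diag n (\<lambda>i. complex_of_real (f (e i))) * mat_adjoint V"
proof -
  let ?M = "\<lambda>g. mat_diag n (\<lambda>i. complex_of_real (g i))"
  let ?U' = "mat_adjoint U" and ?V' = "mat_adjoint V"
  have cU: "U \<in> carrier_mat n n" and cV: "V \<in> carrier_mat n n"
    using U V by (auto simp: spectral_dec_def)
  note cU' = mat_adjoint_carrier[OF cU] and cV' = mat_adjoint_carrier[OF cV]
  have cM: "?M g \<in> carrier_mat n n" for g by simp
  note c = cU cV cU' cV' cM
  have uU: "?U' * U = 1\<^sub>m n" and uU2: "U * ?U' = 1\<^sub>m n"
    and vV: "?V' * V = 1\<^sub>m n" and vV2: "V * ?V' = 1\<^sub>m n"
    using U V by (auto simp: spectral_dec_def)
  have A: "U * ?M d * ?U' = V * ?M e * ?V'" using U V by (simp add: spectral_dec_def)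
  have "?V' * (V * ?M e * ?V') * U = ?V' * V * ?M e * (?V' * U)"
    using c by (simp add: assoc_mult_mat[of _ n n _ n _ n] mult_carrier_mat[of _ n n _ n])
  hence 1: "?V' * (V * ?M e * ?V') * U = ?M e * (?V' * U)" by (simp add: vV left_mult_one_mat[OF cM])
  have "?V' * (U * ?M d * ?U') * U = (?V' * U) * ?M d * (?U' * U)"
    using c by (simp add: assoc_mult_mat[of _ n n _ n _ n] mult_carrier_mat[of _ n n _ n])
  hence 2: "?V' * (U * ?M d * ?U') * U = (?V' * U) * ?M d"
    by (simp add: uU right_mult_one_mat[OF mult_carrier_mat[OF mult_carrier_mat[OF cV' cU] cM]])
  have cW: "?V' * U \<in> carrier_mat n n" using c by simp
  have W: "?M (\<lambda>i. f (e i)) * (?V' * U) = (?V' * U) * ?M (\<lambda>i. f (d i))"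
    by (rule mat_diag_intertwine[OF cW]) (use 1 2 A in simp)
  have "U * ?M (\<lambda>i. f (d i)) * ?U' = (V * ?V') * U * ?M (\<lambda>i. f (d i)) * ?U'"
    using vV2 c by simp
  also have "\<dots> = V * ((?V' * U) * ?M (\<lambda>i. f (d i))) * ?U'"
    using c by (simp add: assoc_mult_mat[of _ n n _ n _ n] mult_carrier_mat[of _ n n _ n])
  also have "\<dots> = V * (?M (\<lambda>i. f (e i)) * (?V' * U)) * ?U'" using W by simp
  also have "\<dots> = V * ?M (\<lambda>i. f (e i)) * ?V' * (U * ?U')"
    using c by (simp add: assoc_mult_mat[of _ n n _ n _ n] mult_carrier_mat[of _ n n _ n])
  also have "\<dots> = V * ?M (\<lambda>i. f (e i)) * ?V'"
    by (simp add: uU2 right_mult_one_mat[OF mult_carrier_mat[OF mult_carrier_mat[OF cV cM] cV']])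
  finally show ?thesis .
qed

lemma mat_fun_eqI:
  assumes A: "A \<in> carrier_mat n n" and U: "spectral_dec n A U d"
  shows "mat_fun f A = U * mat_diag n (\<lambda>i. complex_of_real (f (d i))) * mat_adjoint U"
proof -
  have n: "dim_row A = n" using A by simp
  show ?thesis unfolding mat_fun_def n
    by (rule the_equality) (use U spectral_dec_unique[OF _ U] in blast)+
qed

end

theory Submission
  imports Defs
begin

text \<open>In eigenbases of \<open>A\<close> and \<open>B\<close>, with eigenvalues \<open>d\<^sub>i\<close> and \<open>e\<^sub>j\<close>, every matrix of the
  statement acts on \<open>X\<close> entrywise, and unitary invariance of the norm reduces the claim to the
  scalar inequality for \<open>a = d\<^sub>i\<close>, \<open>b = e\<^sub>j\<close>. There, let \<open>F(t) = (a\<^sup>t b\<^sup>1\<^sup>-\<^sup>t)\<^sup>2\<close> and let \<open>L\<^sub>j\<close> be its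
  piecewise linear interpolant with mesh \<open>2\<^sup>-\<^sup>j\<close>. Halving a mesh interval \<open>[l, u]\<close> lowers the
  interpolant at \<open>\<nu>\<close> by \<open>s\<^sub>j\<^sub>+\<^sub>1(\<nu>)\<close> times the second difference \<open>F(l) + F(u) - 2 F((l + u) / 2)\<close>,
  a perfect square because \<open>F\<close> is geometric. Hence the sum telescopes to \<open>L\<^sub>1(\<nu>) - L\<^sub>N(\<nu>)\<close>;
  moreover \<open>L\<^sub>N \<ge> F\<close> by convexity and \<open>L\<^sub>1(\<nu>) = (\<nu>a + (1 - \<nu>)b)\<^sup>2 - s\<^sub>1(\<nu>)\<^sup>2 (a - b)\<^sup>2\<close>.\<close>

subsection \<open>The scalar inequality\<close>

text \<open>At \<open>x = 1\<close> the right node \<open>(m + 1) / 2 ^ j\<close> lies beyond 1, but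
  its weight is 0.\<close>

definition dyadic_interp :: "(real \<Rightarrow> real) \<Rightarrow> nat \<Rightarrow> real \<Rightarrow> real" where
  "dyadic_interp F j x =
     (let m = of_int \<lfloor>2 ^ j * x\<rfloor> in
       (m + 1 - 2 ^ j * x) * F (m / 2 ^ j) + (2 ^ j * x - m) * F ((m + 1) / 2 ^ j))"

lemma floor_double: "\<lfloor>2 * y\<rfloor> = 2 * \<lfloor>y\<rfloor> \<or> \<lfloor>2 * y\<rfloor> = 2 * \<lfloor>y\<rfloor> + 1" for y :: real
  by linarith

text \<open>The value is the distance from \<open>2 ^ j * x\<close> to a nearest integer: the
  bracket in \<open>s_seq\<close> equals \<open>m\<close> or \<open>m + 1\<close> according to the
  parity of \<open>r_seq\<close>, and the alternating sign makes the difference nonnegative.\<close>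

lemma s_seq_Suc:
  "s_seq (Suc j) x =
    (let m = \<lfloor>2 ^ j * x\<rfloor> in if \<lfloor>2 * (2 ^ j * x)\<rfloor> = 2 * m then 2 ^ j * x - of_int m
       else of_int m + 1 - 2 ^ j * x)"
proof -
  define m where "m = \<lfloor>2 ^ j * x\<rfloor>"
  have r: "r_seq (Suc j) x = \<lfloor>2 * (2 ^ j * x)\<rfloor>"
    by (simp add: r_seq_def mult.assoc)
  consider "r_seq (Suc j) x = 2 * m" | "r_seq (Suc j) x = 2 * m + 1"
    using floor_double[of "2 ^ j * x"] by (auto simp: r m_def)
  then show ?thesis
  proof cases
    case 1
    have "\<lfloor>(of_int (2 * m) + 1) / 2 :: real\<rfloor> = m" by (simp add: floor_eq_iff)
    with 1 show ?thesis
      by (simp add: s_seq_def Let_def power_int_add flip: m_def r)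
  next
    case 2
    have "\<lfloor>(of_int (2 * m + 1) + 1) / 2 :: real\<rfloor> = m + 1" by (simp add: floor_eq_iff)
    with 2 show ?thesis
      by (simp add: s_seq_def Let_def power_int_add flip: m_def r)
  qed
qed

text \<open>On either half of \<open>[l, u]\<close> both interpolants are affine and agree at the
  outer end; at the midpoint they differ by half the second difference, and there
  \<open>s_seq\<close> is 1/2.\<close>

lemma dyadic_interp_diff:
  fixes F :: "real \<Rightarrow> real"
  defines "l \<equiv> \<lambda>j x. of_int (k_seq (Suc j) x) / 2 ^ j"
    and "u \<equiv> \<lambda>j x. of_int (k_seq (Suc j) x + 1) / 2 ^ j"
  shows "dyadic_interp F j x - dyadic_interp F (Suc j) x =
    s_seq (Suc j) x * (F (l j x) + F (u j x) - 2 * F ((l j x + u j x) / 2))"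
proof -
  define y where "y = 2 ^ j * x"
  define m where "m = \<lfloor>y\<rfloor>"
  have k: "k_seq (Suc j) x = m" by (simp add: k_seq_def m_def y_def)
  have y2: "2 ^ Suc j * x = 2 * y" by (simp add: y_def)
  \<comment> \<open>The refined mesh keeps the old nodes at even indices and adds only the
    midpoint.\<close>
  have half: "(of_int m / 2 ^ j + of_int (m + 1) / 2 ^ j) / 2 = (2 * of_int m + 1) / (2 ^ Suc j :: real)"
    by (simp add: field_simps)
  have l': "2 * of_int m / (2 ^ Suc j :: real) = of_int m / 2 ^ j"
    and u': "(2 * of_int m + 2) / (2 ^ Suc j :: real) = (of_int m + 1) / 2 ^ j"
    by (simp_all add: field_simps)
  consider "\<lfloor>2 * y\<rfloor> = 2 * m" | "\<lfloor>2 * y\<rfloor> = 2 * m + 1"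
    using floor_double[of y] by (auto simp: m_def)
  then show ?thesis
  proof cases
    case 1
    have "s_seq (Suc j) x = y - of_int m"
      using 1 unfolding s_seq_Suc by (simp add: Let_def flip: y_def m_def)
    with 1 show ?thesis
      unfolding dyadic_interp_def Let_def l_def u_def k half y2
      by (simp add: l' flip: y_def m_def del: power_Suc) (simp add: algebra_simps)
  next
    case 2
    have "s_seq (Suc j) x = of_int m + 1 - y"
      using 2 unfolding s_seq_Suc by (simp add: Let_def flip: y_def m_def)
    moreover have "(2 * of_int m + 1 + 1) / (2 ^ Suc j :: real) = (of_int m + 1) / 2 ^ j"
      using u' by (simp add: add.commute)
    ultimately show ?thesis using 2
      unfolding dyadic_interp_def Let_def l_def u_def k half y2
      by (simp flip: y_def m_def del: power_Suc) (simp add: algebra_simps)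
  qed
qed

section \<open>Squared weighted geometric means of scalars\<close>

text \<open>\<open>A\<^sup>0 = I\<close> forces \<open>0\<^sup>0 = 1\<close>, while \<open>0 powr 0 = 0\<close>.\<close>

definition pow0 :: "real \<Rightarrow> real \<Rightarrow> real" where
  "pow0 x t = (if t = 0 then 1 else x powr t)"

definition geo_path :: "real \<Rightarrow> real \<Rightarrow> real \<Rightarrow> real" where
  "geo_path a b t = pow0 a t * pow0 b (1 - t)"

lemma geo_path_pos:
  assumes "a > 0" "b > 0"
  shows "geo_path a b t = exp (t * ln a + (1 - t) * ln b)"
  using assms by (simp add: geo_path_def pow0_def powr_def exp_add)

lemma geo_path_zero:
  assumes "a = 0 \<or> b = 0" "0 < t" "t < 1"
  shows "geo_path a b t = 0"
  using assms by (auto simp: geo_path_def pow0_def)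

text \<open>This turns the second difference of the squared path into a perfect square. For positive
  \<open>a\<close>, \<open>b\<close> the path is geometric in \<open>t\<close>. Otherwise the
  midpoint is interior, so the path vanishes there; on the right, \<open>a = 0\<close> kills the
  value at \<open>u > 0\<close> and \<open>b = 0\<close> the value at \<open>l < 1\<close>.\<close>

lemma geo_path_midpoint:
  assumes "a \<ge> 0" "b \<ge> 0" "0 \<le> l" "l < u" "u \<le> 1"
  shows "(geo_path a b ((l + u) / 2))\<^sup>2 = geo_path a b l * geo_path a b u"
proof (cases "a = 0 \<or> b = 0")
  case True
  have "(l + u) / 2 > 0" "(l + u) / 2 < 1" using assms by auto
  moreover have "geo_path a b l * geo_path a b u = 0"
    using True assms by (auto simp: geo_path_def pow0_def)
  ultimately show ?thesis using True geo_path_zero by simp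
next
  case False
  then have "a > 0" "b > 0" using assms by auto
  then show ?thesis
    by (simp add: geo_path_pos power2_eq_square flip: exp_add) (simp add: field_simps)
qed

text \<open>For positive \<open>a\<close>, \<open>b\<close> the square is the exponential of an
  affine function. If \<open>a\<close> or \<open>b\<close> is 0, the path is 0 on the open unit
  interval but may jump at an end, so the weights 0 and 1 are split off first.\<close>

lemma geo_path_convex:
  assumes "a \<ge> 0" "b \<ge> 0" "0 \<le> w" "w \<le> 1" "0 \<le> l" "l < u" "u \<le> 1"
  shows "(geo_path a b ((1 - w) * l + w * u))\<^sup>2
    \<le> (1 - w) * (geo_path a b l)\<^sup>2 + w * (geo_path a b u)\<^sup>2"
proof (cases "w = 0 \<or> w = 1")
  case True
  then show ?thesis by auto
next
  case w: False
  show ?thesis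
  proof (cases "a = 0 \<or> b = 0")
    case True
    have "(1 - w) * l + w * u = l + w * (u - l)" by (simp add: algebra_simps)
    moreover have "0 < w * (u - l)" "w * (u - l) < u - l" using w assms by auto
    ultimately have "(1 - w) * l + w * u > 0" "(1 - w) * l + w * u < 1"
      using assms by linarith+
    then show ?thesis using True geo_path_zero assms by simp
  next
    case False
    then have pos: "a > 0" "b > 0" using assms by auto
    define h where "h t = 2 * (t * ln a + (1 - t) * ln b)" for t
    have sq: "(geo_path a b t)\<^sup>2 = exp (h t)" for t
      using pos by (simp add: geo_path_pos h_def power2_eq_square flip: exp_add)
    define z where "z = h ((1 - w) * l + w * u)"
    have z: "(1 - w) * h l + w * h u = z"
      by (simp add: z_def h_def algebra_simps)
    have tangent: "exp z * (1 + (y - z)) \<le> exp y" for y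
      using mult_left_mono[OF exp_ge_add_one_self[of "y - z"], of "exp z"]
      by (simp flip: exp_add)
    \<comment> \<open>The linear terms of the tangent at \<open>z\<close> cancel, as
      \<open>z\<close> is the weighted mean of \<open>h l\<close> and \<open>h u\<close>.\<close>
    have "exp z = (1 - w) * (exp z * (1 + (h l - z))) + w * (exp z * (1 + (h u - z)))"
      using arg_cong[OF z, of "\<lambda>t. exp z * t"] by (simp add: algebra_simps)
    also have "\<dots> \<le> (1 - w) * exp (h l) + w * exp (h u)"
      using assms by (intro add_mono mult_left_mono tangent) auto
    finally show ?thesis by (simp add: sq z_def)
  qed
qed

text \<open>The mesh interval that contains \<open>x\<close> stays inside the unit interval. At
  \<open>x = 1\<close> it would start at 1, which is why that point is treated apart below.\<close>

lemma floor_dyadic_bounds: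
  fixes x :: real
  assumes "0 \<le> x" "x < 1"
  shows "0 \<le> \<lfloor>2 ^ j * x\<rfloor>" "of_int \<lfloor>2 ^ j * x\<rfloor> + 1 \<le> (2 ^ j :: real)"
proof -
  have "2 ^ j * x < 2 ^ j" using assms by simp
  then have "\<lfloor>2 ^ j * x\<rfloor> < 2 ^ j" by (simp add: floor_less_iff)
  then have "\<lfloor>2 ^ j * x\<rfloor> + 1 \<le> 2 ^ j" by simp
  then have "real_of_int (\<lfloor>2 ^ j * x\<rfloor> + 1) \<le> real_of_int (2 ^ j)"
    by (rule of_int_le_iff[THEN iffD2])
  then show "of_int \<lfloor>2 ^ j * x\<rfloor> + 1 \<le> (2 ^ j :: real)" by simp
qed (use assms in simp)

text \<open>A chord of a convex function lies above its graph; \<open>w\<close> is the relative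
  position of \<open>x\<close> in its mesh interval. At \<open>x = 1\<close> the interpolant is the
  value at the node 1.\<close>

lemma le_dyadic_interp:
  assumes "a \<ge> 0" "b \<ge> 0" "0 \<le> x" "x \<le> 1"
  shows "(geo_path a b x)\<^sup>2 \<le> dyadic_interp (\<lambda>t. (geo_path a b t)\<^sup>2) j x"
proof (cases "x = 1")
  case True
  have "\<lfloor>2 ^ j :: real\<rfloor> = 2 ^ j"
    by (metis floor_of_int of_int_numeral of_int_power)
  then show ?thesis by (simp add: dyadic_interp_def True)
next
  case False
  define m where "m = real_of_int \<lfloor>2 ^ j * x\<rfloor>"
  define w where "w = 2 ^ j * x - m"
  have b: "0 \<le> m" "m + 1 \<le> 2 ^ j"
    using floor_dyadic_bounds[of x j] False assms by (auto simp: m_def)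
  have w: "0 \<le> w" "w \<le> 1" unfolding w_def m_def by linarith+
  have "(1 - w) * (m / 2 ^ j) + w * ((m + 1) / 2 ^ j) = (m + w) / 2 ^ j"
    by (simp add: field_simps)
  also have "\<dots> = x" by (simp add: w_def)
  finally have x: "(1 - w) * (m / 2 ^ j) + w * ((m + 1) / 2 ^ j) = x" .
  have "(geo_path a b x)\<^sup>2
      \<le> (1 - w) * (geo_path a b (m / 2 ^ j))\<^sup>2 + w * (geo_path a b ((m + 1) / 2 ^ j))\<^sup>2"
    using geo_path_convex[of a b w "m / 2 ^ j" "(m + 1) / 2 ^ j", unfolded x] assms w b
    by (simp add: divide_strict_right_mono)
  also have "\<dots> = dyadic_interp (\<lambda>t. (geo_path a b t)\<^sup>2) j x"
    by (simp add: dyadic_interp_def Let_def w_def flip: m_def)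
  finally show ?thesis .
qed

text \<open>The midpoint identity makes each summand one step of a telescoping sum. At
  \<open>x = 1\<close> both sides vanish with \<open>s_seq\<close>, whatever value the power with
  exponent outside the unit interval takes.\<close>

lemma geo_path_summand:
  assumes "a \<ge> 0" "b \<ge> 0" "0 \<le> x" "x \<le> 1"
  shows "s_seq (Suc j) x * (geo_path a b (of_int (k_seq (Suc j) x) / 2 ^ j)
           - geo_path a b (of_int (k_seq (Suc j) x + 1) / 2 ^ j))\<^sup>2
    = dyadic_interp (\<lambda>t. (geo_path a b t)\<^sup>2) j x
      - dyadic_interp (\<lambda>t. (geo_path a b t)\<^sup>2) (Suc j) x"
proof (cases "x = 1")
  case True
  have "\<lfloor>2 ^ j :: real\<rfloor> = 2 ^ j" for j
    by (metis floor_of_int of_int_numeral of_int_power)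
  from this[of j] this[of "Suc j"] have "s_seq (Suc j) x = 0"
    unfolding s_seq_Suc True by simp
  then show ?thesis by (simp add: dyadic_interp_diff)
next
  case False
  define l where "l = real_of_int (k_seq (Suc j) x) / 2 ^ j"
  define u where "u = real_of_int (k_seq (Suc j) x + 1) / 2 ^ j"
  have "0 \<le> l" "l < u" "u \<le> 1"
    using floor_dyadic_bounds[of x j] False assms
    by (auto simp: l_def u_def k_seq_def divide_strict_right_mono)
  from geo_path_midpoint[OF assms(1,2) this]
  show ?thesis
    unfolding dyadic_interp_diff l_def[symmetric] u_def[symmetric]
    by (simp add: power2_diff)
qed

text \<open>Expand the right-hand square about \<open>b\<close> if \<open>x < 1 / 2\<close> and
  about \<open>a\<close> otherwise. The interpolant through \<open>b\<^sup>2\<close>,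
  \<open>a * b\<close>, \<open>a\<^sup>2\<close> is the constant and linear part; the quadratic
  coefficient is \<open>x\<^sup>2\<close> or \<open>(1 - x)\<^sup>2\<close>, that is, the square of
  \<open>s_seq 1 x\<close>.\<close>

lemma dyadic_interp_1:
  assumes "a \<ge> 0" "b \<ge> 0" "0 \<le> x" "x \<le> 1"
  shows "dyadic_interp (\<lambda>t. (geo_path a b t)\<^sup>2) 1 x + (s_seq 1 x)\<^sup>2 * (a - b)\<^sup>2
    = (x * a + (1 - x) * b)\<^sup>2"
proof -
  have g: "geo_path a b 0 = b" "geo_path a b 1 = a" "(geo_path a b (1 / 2))\<^sup>2 = a * b"
    using assms by (auto simp: geo_path_def pow0_def powr_half_sqrt power_mult_distrib)
  consider "x < 1 / 2" | "1 / 2 \<le> x" "x < 1" | "x = 1" using assms by linarith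
  then show ?thesis
  proof cases
    case 1
    then have "\<lfloor>2 * x\<rfloor> = 0" "\<lfloor>x\<rfloor> = 0" using assms by (auto simp: floor_eq_iff)
    then show ?thesis using g s_seq_Suc[of 0 x]
      by (simp add: dyadic_interp_def) (simp add: algebra_simps power2_eq_square)
  next
    case 2
    then have "\<lfloor>2 * x\<rfloor> = 1" "\<lfloor>x\<rfloor> = 0" using assms by (auto simp: floor_eq_iff)
    then show ?thesis using g s_seq_Suc[of 0 x]
      by (simp add: dyadic_interp_def) (simp add: algebra_simps power2_eq_square)
  next
    case 3
    then show ?thesis using g s_seq_Suc[of 0 x]
      by (simp add: dyadic_interp_def)
  qed
qed

proposition refined_young_sq:
  assumes "a \<ge> 0" "b \<ge> 0" "0 \<le> x" "x \<le> 1" "N \<ge> 1"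
  shows "(geo_path a b x)\<^sup>2 + (s_seq 1 x)\<^sup>2 * (a - b)\<^sup>2
    + (\<Sum>j=2..N. s_seq j x * (geo_path a b (of_int (k_seq j x) / 2 ^ (j - 1))
           - geo_path a b (of_int (k_seq j x + 1) / 2 ^ (j - 1)))\<^sup>2)
    \<le> (x * a + (1 - x) * b)\<^sup>2"
proof -
  define L where "L j = dyadic_interp (\<lambda>t. (geo_path a b t)\<^sup>2) j x" for j
  have "(\<Sum>j=2..N. s_seq j x * (geo_path a b (of_int (k_seq j x) / 2 ^ (j - 1))
           - geo_path a b (of_int (k_seq j x + 1) / 2 ^ (j - 1)))\<^sup>2)
      = (\<Sum>j=2..N. L (j - 1) - L j)"
  proof (rule sum.cong)
    fix j assume "j \<in> {2..N}"
    then obtain i where "j = Suc i" by (cases j) auto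
    then show "s_seq j x * (geo_path a b (of_int (k_seq j x) / 2 ^ (j - 1))
           - geo_path a b (of_int (k_seq j x + 1) / 2 ^ (j - 1)))\<^sup>2 = L (j - 1) - L j"
      using geo_path_summand[OF assms(1-4), of i] by (simp add: L_def)
  qed simp
  \<comment> \<open>The induction starts at 1, where the sum is empty.\<close>
  also have "\<dots> = L 1 - L N"
    using \<open>N \<ge> 1\<close> by (induction N rule: dec_induct) auto
  finally show ?thesis
    using le_dyadic_interp[OF assms(1-4), of N] dyadic_interp_1[OF assms(1-4)]
    by (simp add: L_def)
qed

subsection \<open>Unitary matrices and the spectral theorem\<close>

lemma mat_adjoint_dim [simp]: "dim_row (mat_adjoint A) = dim_col A" "dim_col (mat_adjoint A) = dim_row A"
  by (simp_all add: mat_adjoint_def)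

lemma mat_adjoint_index [simp]:
  "i < dim_col A \<Longrightarrow> j < dim_row A \<Longrightarrow> mat_adjoint A $$ (i, j) = conjugate (A $$ (j, i))"
  by (simp add: mat_adjoint_def mat_of_rows_index)

lemma mat_adjoint_adjoint [simp]: "mat_adjoint (mat_adjoint A) = A"
  by (intro eq_matI) auto

lemma mat_adjoint_mult:
  fixes A B :: "complex mat"
  assumes A: "A \<in> carrier_mat n m" and B: "B \<in> carrier_mat m k"
  shows "mat_adjoint (A * B) = mat_adjoint B * mat_adjoint A"
proof (rule eq_matI)
  fix i j assume "i < dim_row (mat_adjoint B * mat_adjoint A)"
    "j < dim_col (mat_adjoint B * mat_adjoint A)"
  then have ij: "i < k" "j < n" using A B by auto
  have "mat_adjoint (A * B) $$ (i, j) = (\<Sum>l=0..<m. cnj (A $$ (j, l)) * cnj (B $$ (l, i)))"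
    using ij A B by (simp add: scalar_prod_def)
  also have "\<dots> = (\<Sum>l=0..<m. cnj (B $$ (l, i)) * cnj (A $$ (j, l)))"
    by (intro sum.cong) auto
  also have "\<dots> = (mat_adjoint B * mat_adjoint A) $$ (i, j)"
    using ij A B by (simp add: scalar_prod_def)
  finally show "mat_adjoint (A * B) $$ (i, j) = (mat_adjoint B * mat_adjoint A) $$ (i, j)" .
qed (use A B in auto)

text \<open>A proof of unitarity has to check one product only; \<open>unitary_matD\<close> recovers
  the other from the fact that a one-sided inverse of a square matrix is two-sided.\<close>

definition unitary_mat :: "nat \<Rightarrow> complex mat \<Rightarrow> bool" where
  "unitary_mat n U \<longleftrightarrow> U \<in> carrier_mat n n \<and> mat_adjoint U * U = 1\<^sub>m n"

lemma unitary_matD: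
  assumes "unitary_mat n U"
  shows "U \<in> carrier_mat n n" "mat_adjoint U \<in> carrier_mat n n"
    "mat_adjoint U * U = 1\<^sub>m n" "U * mat_adjoint U = 1\<^sub>m n"
  using assms mat_mult_left_right_inverse[of "mat_adjoint U" n U]
  by (auto simp: unitary_mat_def mat_adjoint_carrier)

lemma unitary_mat_adjoint: "unitary_mat n U \<Longrightarrow> unitary_mat n (mat_adjoint U)"
  by (simp add: unitary_mat_def unitary_matD(2,4)[of n U])

lemma adjoint_conj_cancel:
  assumes U: "unitary_mat n U" and V: "unitary_mat m V" and Z: "Z \<in> carrier_mat n m"
  shows "mat_adjoint U * (U * Z * mat_adjoint V) * V = Z"
proof -
  note c = unitary_matD[OF U] unitary_matD[OF V] Z
  have "mat_adjoint U * (U * Z * mat_adjoint V) * V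
      = (mat_adjoint U * U) * Z * (mat_adjoint V * V)"
    using c(1,2,5,6,9)
    by (simp add: assoc_mult_mat[of _ n n _ n _ m] assoc_mult_mat[of _ n n _ m _ m]
        assoc_mult_mat[of _ n m _ m _ m] mult_carrier_mat[of _ n n _ n]
        mult_carrier_mat[of _ n n _ m] mult_carrier_mat[of _ n m _ m])
  also have "\<dots> = Z" using c by simp
  finally show ?thesis .
qed

lemma unitary_mult:
  assumes U: "unitary_mat n U" and V: "unitary_mat n V"
  shows "unitary_mat n (U * V)"
proof -
  note c = unitary_matD[OF U] unitary_matD[OF V]
  have "mat_adjoint (U * V) * (U * V) = mat_adjoint V * (mat_adjoint U * U) * V"
    using c(1,2,5,6)
    by (simp add: mat_adjoint_mult[of _ n n _ n] assoc_mult_mat[of _ n n _ n _ n]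
        mult_carrier_mat[of _ n n _ n])
  also have "\<dots> = 1\<^sub>m n" using c by simp
  finally show ?thesis using c by (simp add: unitary_mat_def)
qed

lemma spectral_dec_alt:
  "spectral_dec n A U d \<longleftrightarrow> unitary_mat n U \<and>
     A = U * mat_diag n (\<lambda>i. complex_of_real (d i)) * mat_adjoint U"
  using unitary_matD(4)[of n U] unfolding spectral_dec_def unitary_mat_def by blast

lemma spectral_dec_conj:
  assumes W: "unitary_mat n W" and B: "spectral_dec n B U d"
  shows "spectral_dec n (W * B * mat_adjoint W) (W * U) d"
proof -
  have U: "unitary_mat n U" using B by (simp add: spectral_dec_alt)
  note c = unitary_matD[OF W] unitary_matD[OF U]
  have cD: "mat_diag n (\<lambda>i. complex_of_real (d i)) \<in> carrier_mat n n" by simp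
  have "W * B * mat_adjoint W =
      (W * U) * mat_diag n (\<lambda>i. complex_of_real (d i)) * mat_adjoint (W * U)"
    using c(1,2,5,6) cD B
    by (simp add: spectral_dec_alt mat_adjoint_mult[of _ n n _ n] assoc_mult_mat[of _ n n _ n _ n]
        mult_carrier_mat[of _ n n _ n])
  then show ?thesis using unitary_mult[OF W U] by (simp add: spectral_dec_alt)
qed

section \<open>Diagonalization of Hermitian and positive semidefinite matrices\<close>

lemma scalar_self_pos:
  fixes w :: "complex vec"
  assumes "w \<bullet>c w \<noteq> 0"
  shows "w \<bullet>c w = of_real (Re (w \<bullet>c w))" "Re (w \<bullet>c w) > 0"
proof -
  have "w \<bullet>c w = of_real (\<Sum>i<dim_vec w. (cmod (w $ i))\<^sup>2)"
    by (simp add: scalar_prod_def complex_norm_square lessThan_atLeast0 del: of_real_power)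
  moreover have "(\<Sum>i<dim_vec w. (cmod (w $ i))\<^sup>2) \<ge> 0" by (intro sum_nonneg) simp
  ultimately show "w \<bullet>c w = of_real (Re (w \<bullet>c w))" "Re (w \<bullet>c w) > 0"
    using assms by (auto simp: order_less_le simp del: of_real_sum of_real_power)
qed

text \<open>A root of the characteristic polynomial gives an eigenvector. It is completed to a basis
  and orthogonalized by Gram-Schmidt, which leaves the first vector unchanged; then the columns are
  normalized.\<close>

lemma eigenvector_unitary:
  fixes A :: "complex mat"
  assumes A: "A \<in> carrier_mat n n" and n: "n > 0"
  obtains U e where "unitary_mat n U" "A *\<^sub>v col U 0 = e \<cdot>\<^sub>v col U 0"
proof -
  from char_poly_factorized[OF A] obtain es
    where es: "char_poly A = (\<Prod>a\<leftarrow>es. [:- a, 1:])" "length es = n" by blast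
  then obtain e es' where "es = e # es'" using n by (cases es) auto
  with es have "eigenvalue A e" by (simp add: eigenvalue_root_char_poly[OF A])
  then obtain v where v: "v \<in> carrier_vec n" "v \<noteq> 0\<^sub>v n" "A *\<^sub>v v = e \<cdot>\<^sub>v v"
    using A by (auto simp: eigenvalue_def eigenvector_def)
  interpret cof_vec_space n "TYPE(complex)" .
  define b where "b = basis_completion v"
  note b = basis_completion[OF v(1,2), folded b_def]
  define ws where "ws = gram_schmidt n b"
  note ws = gram_schmidt_result[OF b(2,4,5) ws_def]
  obtain vs where "b = v # vs" using b(6,7) n by (cases b) auto
  with gram_schmidt_hd[OF v(1), of vs] have "hd ws = v" by (simp add: ws_def)
  then have ws0: "ws ! 0 = v" using ws(4) b(6) n by (cases ws) auto
  have len: "length ws = n" using ws(4) b(6) by simp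
  define c where "c i = complex_of_real (1 / sqrt (Re (ws ! i \<bullet>c ws ! i)))" for i
  define U where "U = mat_of_cols n (map (\<lambda>i. c i \<cdot>\<^sub>v ws ! i) [0..<n])"
  have wsc: "ws ! i \<in> carrier_vec n" if "i < n" for i
    using ws(3) len that by (metis nth_mem subsetD)
  have UC: "U \<in> carrier_mat n n" by (simp add: U_def carrier_matI)
  have col: "col U i = c i \<cdot>\<^sub>v ws ! i" if "i < n" for i
    using that wsc[OF that] by (simp add: U_def)
  have "mat_adjoint U * U = 1\<^sub>m n"
  proof (rule eq_matI)
    fix i j assume "i < dim_row (1\<^sub>m n :: complex mat)" "j < dim_col (1\<^sub>m n :: complex mat)"
    then have ij: "i < n" "j < n" by auto
    have "(mat_adjoint U * U) $$ (i, j) = conjugate (col U i) \<bullet> col U j"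
      using ij UC by (simp add: mat_adjoint_def)
    also have "\<dots> = col U j \<bullet>c col U i"
      using UC ij by (intro comm_scalar_prod[of _ n]) auto
    also have "\<dots> = c j * c i * (ws ! j \<bullet>c ws ! i)"
      using ij wsc[OF ij(1)] wsc[OF ij(2)]
      by (simp add: col conjugate_smult_vec c_def mult.assoc)
    also have "\<dots> = 1\<^sub>m n $$ (i, j)"
    proof (cases "i = j")
      case True
      \<comment> \<open>Orthogonality in the library includes nonzero self-products;
        \<open>scalar_self_pos\<close> makes them positive reals, so the square root in
        \<open>c\<close> is the length.\<close>
      have nz: "ws ! i \<bullet>c ws ! i \<noteq> 0" using corthogonalD[OF ws(2)] ij len by auto
      note p = scalar_self_pos[OF nz]
      have "c i * c i = complex_of_real (1 / Re (ws ! i \<bullet>c ws ! i))"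
        using p(2) by (simp add: c_def flip: of_real_mult)
      then have "c i * c i * (ws ! i \<bullet>c ws ! i) = 1"
        using p by (metis nonzero_divide_eq_eq of_real_1 of_real_mult order_less_irrefl)
      then show ?thesis using ij True by simp
    next
      case False
      then have "ws ! j \<bullet>c ws ! i = 0" using corthogonalD[OF ws(2)] ij len by auto
      then show ?thesis using ij False by simp
    qed
    finally show "(mat_adjoint U * U) $$ (i, j) = 1\<^sub>m n $$ (i, j)" .
  qed (use UC in auto)
  then have "unitary_mat n U" using UC by (simp add: unitary_mat_def)
  moreover have "A *\<^sub>v col U 0 = e \<cdot>\<^sub>v col U 0"
    using v A n by (simp add: col ws0 mult_mat_vec smult_smult_assoc mult.commute)
  ultimately show thesis by (rule that)
qed

text \<open>Block diagonal matrices multiply blockwise, and \<open>case_nat e d\<close> puts the new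
  eigenvalue in front. This is the gluing step of the induction for the spectral theorem.\<close>

lemma spectral_dec_block:
  assumes "spectral_dec n A U d"
  shows "spectral_dec (Suc n)
    (four_block_mat (mat 1 1 (\<lambda>_. complex_of_real e)) (0\<^sub>m 1 n) (0\<^sub>m n 1) A)
    (four_block_mat (1\<^sub>m 1) (0\<^sub>m 1 n) (0\<^sub>m n 1) U) (case_nat e d)"
proof -
  have U: "unitary_mat n U" and A: "A = U * mat_diag n (\<lambda>i. complex_of_real (d i)) * mat_adjoint U"
    using assms by (auto simp: spectral_dec_alt)
  note c = unitary_matD[OF U]
  let ?W = "four_block_mat (1\<^sub>m 1) (0\<^sub>m 1 n) (0\<^sub>m n 1) U"
  let ?D = "mat_diag n (\<lambda>i. complex_of_real (d i))"
  let ?E = "mat 1 1 (\<lambda>_. complex_of_real e)"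
  have adj: "mat_adjoint ?W = four_block_mat (1\<^sub>m 1) (0\<^sub>m 1 n) (0\<^sub>m n 1) (mat_adjoint U)"
    using c by (intro eq_matI) auto
  have diag: "mat_diag (Suc n) (\<lambda>i. complex_of_real (case_nat e d i))
      = four_block_mat ?E (0\<^sub>m 1 n) (0\<^sub>m n 1) ?D"
    by (intro eq_matI) (auto simp: mat_diag_def split: nat.split)
  have one: "four_block_mat (1\<^sub>m 1) (0\<^sub>m 1 n) (0\<^sub>m n 1) (1\<^sub>m n) = (1\<^sub>m (Suc n) :: complex mat)"
    by (intro eq_matI) auto
  have mult: "four_block_mat P (0\<^sub>m 1 n) (0\<^sub>m n 1) Q * four_block_mat R (0\<^sub>m 1 n) (0\<^sub>m n 1) S
      = four_block_mat (P * R) (0\<^sub>m 1 n) (0\<^sub>m n 1) (Q * S)"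
    if "P \<in> carrier_mat 1 1" "R \<in> carrier_mat 1 1" "Q \<in> carrier_mat n n" "S \<in> carrier_mat n n"
    for P Q R S :: "complex mat"
    using that by (subst mult_four_block_mat[of _ 1 1 _ n _ n _ _ 1 _ n]) auto
  have E: "?E \<in> carrier_mat 1 1" and D: "?D \<in> carrier_mat n n" by auto
  have "mat_adjoint ?W * ?W = 1\<^sub>m (Suc n)"
    unfolding adj mult[OF one_carrier_mat one_carrier_mat c(2,1)] c(3)
    by (simp only: left_mult_one_mat[OF one_carrier_mat] one)
  moreover have "?W \<in> carrier_mat (Suc n) (Suc n)"
    using four_block_carrier_mat[OF one_carrier_mat[of 1] c(1)] by simp
  ultimately have "unitary_mat (Suc n) ?W"
    by (simp only: unitary_mat_def)
  moreover have "?W * mat_diag (Suc n) (\<lambda>i. complex_of_real (case_nat e d i)) * mat_adjoint ?W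
      = four_block_mat ?E (0\<^sub>m 1 n) (0\<^sub>m n 1) A"
    unfolding adj diag A mult[OF one_carrier_mat E c(1) D]
      mult[OF mult_carrier_mat[OF one_carrier_mat E] one_carrier_mat mult_carrier_mat[OF c(1) D] c(2)]
    by (simp only: left_mult_one_mat[OF E] right_mult_one_mat[OF E])
  ultimately show ?thesis by (simp only: spectral_dec_alt)
qed

text \<open>Deflation: in an orthonormal basis that starts with an eigenvector, the first column is
  \<open>e\<close> times the first unit vector. Hermitian symmetry then clears the first row and
  makes \<open>e\<close> real, and the remaining block \<open>C\<close> is Hermitian of size
  \<open>n\<close>.\<close>

theorem hermitian_spectral_dec:
  assumes "A \<in> carrier_mat n n" "mat_adjoint A = A"
  shows "\<exists>U d. spectral_dec n A U d"
  using assms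
proof (induction n arbitrary: A)
  case 0
  then have "spectral_dec 0 A (1\<^sub>m 0) (\<lambda>_. 0)"
    by (auto simp: spectral_dec_alt unitary_mat_def intro!: eq_matI)
  then show ?case by blast
next
  case (Suc n)
  from Suc.prems(1) obtain W e where W: "unitary_mat (Suc n) W"
    and ev: "A *\<^sub>v col W 0 = e \<cdot>\<^sub>v col W 0"
    by (rule eigenvector_unitary) simp
  note c = unitary_matD[OF W] and A = Suc.prems(1)
  define B where "B = mat_adjoint W * A * W"
  have B: "B \<in> carrier_mat (Suc n) (Suc n)" using c A by (simp add: B_def)
  have AB: "A = W * B * mat_adjoint W"
    using adjoint_conj_cancel[OF unitary_mat_adjoint[OF W] unitary_mat_adjoint[OF W] A]
    by (simp add: B_def)
  have herm: "mat_adjoint B = B"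
    using c(1,2) A Suc.prems(2)
    by (simp add: B_def mat_adjoint_mult[of _ "Suc n" "Suc n" _ "Suc n"]
        assoc_mult_mat[of _ "Suc n" "Suc n" _ "Suc n" _ "Suc n"]
        mult_carrier_mat[of _ "Suc n" "Suc n" _ "Suc n"])
  have conj_B: "B $$ (i, j) = cnj (B $$ (j, i))" if "i < Suc n" "j < Suc n" for i j
    using that B arg_cong[OF herm, of "\<lambda>M. M $$ (i, j)"] by simp
  have B0: "B $$ (i, 0) = (if i = 0 then e else 0)" if i: "i < Suc n" for i
  proof -
    have "B $$ (i, 0) = row (mat_adjoint W) i \<bullet> (A *\<^sub>v col W 0)"
      using i c(1,2) A by (simp add: B_def assoc_mult_mat[of _ "Suc n" "Suc n" _ "Suc n" _ "Suc n"]
          del: col_mult)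
    also have "\<dots> = e * (mat_adjoint W * W) $$ (i, 0)"
      using i c(1,2) by (simp add: ev)
    finally show ?thesis using i by (simp add: c(3))
  qed
  have e: "complex_of_real (Re e) = e"
    using conj_B[of 0 0] B0[of 0] by (simp add: complex_eq_iff)
  have B0': "B $$ (0, j) = (if j = 0 then e else 0)" if "j < Suc n" for j
    using conj_B[of 0 j] B0[OF that] e that by (auto simp: complex_eq_iff)
  define C where "C = mat n n (\<lambda>(i, j). B $$ (Suc i, Suc j))"
  have C: "C \<in> carrier_mat n n" by (simp add: C_def)
  have "mat_adjoint C = C"
    by (intro eq_matI) (auto simp: C_def simp flip: conj_B)
  from Suc.IH[OF C this] obtain U d where "spectral_dec n C U d" by blast
  note * = spectral_dec_block[OF this, of "Re e"]
  have "four_block_mat (mat 1 1 (\<lambda>_. complex_of_real (Re e))) (0\<^sub>m 1 n) (0\<^sub>m n 1) C = B"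
    using B by (intro eq_matI) (auto simp: C_def B0 B0' e)
  with spectral_dec_conj[OF W *] show ?case by (auto simp flip: AB)
qed

text \<open>The eigenvalue \<open>d i\<close> is the value of the quadratic form of \<open>A\<close>
  at column \<open>i\<close> of \<open>U\<close>.\<close>

lemma psd_mat_spectral_dec:
  assumes "psd_mat n A"
  obtains U d where "spectral_dec n A U d" "\<And>i. i < n \<Longrightarrow> 0 \<le> d i"
proof -
  have A: "A \<in> carrier_mat n n"
    and pos: "\<And>v. v \<in> carrier_vec n \<Longrightarrow> 0 \<le> Re ((A *\<^sub>v v) \<bullet>c v)"
    using assms by (auto simp: psd_mat_def)
  obtain U d where dec: "spectral_dec n A U d"
    using hermitian_spectral_dec[OF A] assms by (auto simp: psd_mat_def)
  then have U: "unitary_mat n U" by (simp add: spectral_dec_alt)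
  note c = unitary_matD[OF U]
  have D: "mat_adjoint U * A * U = mat_diag n (\<lambda>i. complex_of_real (d i))"
    using dec adjoint_conj_cancel[OF U U] by (simp add: spectral_dec_alt)
  have "0 \<le> d i" if i: "i < n" for i
  proof -
    have "complex_of_real (d i) = (mat_adjoint U * (A * U)) $$ (i, i)"
      using i arg_cong[OF D, of "\<lambda>M. M $$ (i, i)"] c(1,2) A
      by (simp add: assoc_mult_mat[of _ n n _ n _ n] mat_diag_def)
    also have "\<dots> = conjugate (col U i) \<bullet> (A *\<^sub>v col U i)"
      using i c(1) A by (simp add: mat_adjoint_def del: col_mult)
    also have "\<dots> = (A *\<^sub>v col U i) \<bullet>c col U i"
      using i c(1) A by (intro comm_scalar_prod[of _ n]) auto
    finally have "d i = Re ((A *\<^sub>v col U i) \<bullet>c col U i)"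
      by (metis Re_complex_of_real)
    then show ?thesis using pos[of "col U i"] c(1) i by simp
  qed
  with dec show thesis by (rule that)
qed

subsection \<open>The Hilbert-Schmidt norm\<close>

lemma hs_norm_sq: "(hs_norm A)\<^sup>2 = (\<Sum>i<dim_row A. \<Sum>j<dim_col A. (cmod (A $$ (i, j)))\<^sup>2)"
  unfolding hs_norm_def by (intro real_sqrt_pow2 sum_nonneg) simp

lemma hs_norm_adjoint: "hs_norm (mat_adjoint A) = hs_norm A"
proof -
  have "(\<Sum>i<dim_col A. \<Sum>j<dim_row A. (cmod (mat_adjoint A $$ (i, j)))\<^sup>2)
      = (\<Sum>i<dim_col A. \<Sum>j<dim_row A. (cmod (A $$ (j, i)))\<^sup>2)"
    by (intro sum.cong) auto
  also have "\<dots> = (\<Sum>j<dim_row A. \<Sum>i<dim_col A. (cmod (A $$ (j, i)))\<^sup>2)"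
    by (rule sum.swap)
  finally show ?thesis by (simp only: hs_norm_def mat_adjoint_dim)
qed

text \<open>In this form a unitary left factor of \<open>A\<close> cancels inside the product, which
  gives invariance.\<close>

lemma hs_norm_sq_eq_trace:
  "complex_of_real ((hs_norm A)\<^sup>2) = (\<Sum>j<dim_col A. (mat_adjoint A * A) $$ (j, j))"
proof -
  have "(mat_adjoint A * A) $$ (j, j) = of_real (\<Sum>i<dim_row A. (cmod (A $$ (i, j)))\<^sup>2)"
    if "j < dim_col A" for j
  proof -
    have "(mat_adjoint A * A) $$ (j, j) = (\<Sum>i<dim_row A. cnj (A $$ (i, j)) * A $$ (i, j))"
      using that by (simp add: scalar_prod_def lessThan_atLeast0)
    then show ?thesis
      by (simp only: of_real_sum complex_norm_square mult.commute)
  qed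
  then have "(\<Sum>j<dim_col A. (mat_adjoint A * A) $$ (j, j))
      = of_real (\<Sum>j<dim_col A. \<Sum>i<dim_row A. (cmod (A $$ (i, j)))\<^sup>2)"
    unfolding of_real_sum by (intro sum.cong) auto
  then show ?thesis unfolding hs_norm_sq by (subst sum.swap) (simp only:)
qed

lemma hs_norm_unitary_left:
  assumes U: "unitary_mat n U" and Z: "Z \<in> carrier_mat n m"
  shows "hs_norm (U * Z) = hs_norm Z"
proof -
  note c = unitary_matD[OF U]
  have "mat_adjoint (U * Z) * (U * Z) = mat_adjoint Z * (mat_adjoint U * U * Z)"
    using c(1,2) Z mat_adjoint_carrier[OF Z]
    by (simp add: mat_adjoint_mult[of _ n n _ m] assoc_mult_mat[of _ m n _ n _ m]
        assoc_mult_mat[of _ n n _ n _ m])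
  also have "\<dots> = mat_adjoint Z * Z" using c Z by simp
  finally have "complex_of_real ((hs_norm (U * Z))\<^sup>2) = complex_of_real ((hs_norm Z)\<^sup>2)"
    unfolding hs_norm_sq_eq_trace using c(1) Z by simp
  then have "(hs_norm (U * Z))\<^sup>2 = (hs_norm Z)\<^sup>2" unfolding of_real_eq_iff .
  then show ?thesis
    by (rule power2_eq_imp_eq) (simp_all add: hs_norm_def sum_nonneg)
qed

text \<open>Taking the adjoint preserves the norm and moves the right factor to the left.\<close>

lemma hs_norm_unitary_conj:
  assumes U: "unitary_mat n U" and V: "unitary_mat m V" and Z: "Z \<in> carrier_mat n m"
  shows "hs_norm (U * Z * mat_adjoint V) = hs_norm Z"
proof -
  note c = unitary_matD[OF U] unitary_matD[OF V]
  have "hs_norm (U * Z * mat_adjoint V) = hs_norm (V * mat_adjoint (U * Z))"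
    using mat_adjoint_mult[of "U * Z" n m "mat_adjoint V" m] c(1,6) Z
    by (metis hs_norm_adjoint mat_adjoint_adjoint mult_carrier_mat)
  also have "\<dots> = hs_norm (U * Z)"
    using hs_norm_unitary_left[OF V, of "mat_adjoint (U * Z)" n] mult_carrier_mat[OF c(1) Z]
    by (simp add: hs_norm_adjoint mat_adjoint_carrier)
  also have "\<dots> = hs_norm Z" by (rule hs_norm_unitary_left[OF U Z])
  finally show ?thesis .
qed

section \<open>Reduction of the matrix inequality to eigenvalues\<close>

lemma mat_powr_spectral:
  assumes "spectral_dec n A U d"
  shows "mat_powr A t = U * mat_diag n (\<lambda>i. complex_of_real (pow0 (d i) t)) * mat_adjoint U"
proof -
  have "A \<in> carrier_mat n n"
    using assms by (auto simp: spectral_dec_def mat_adjoint_carrier)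
  from mat_fun_eqI[OF this assms] show ?thesis
    unfolding mat_powr_def by (simp add: pow0_def)
qed

theorem theorem5p1:
  fixes A B X :: "complex mat" and n N :: nat and \<nu> :: real
  assumes "psd_mat n A" and "psd_mat n B" and "X \<in> carrier_mat n n"
    and "0 \<le> \<nu>" and "\<nu> \<le> 1" and "N \<ge> 2"
  shows "(hs_norm (mat_powr A \<nu> * X * mat_powr B (1 - \<nu>)))\<^sup>2
      + (s_seq 1 \<nu>)\<^sup>2 * (hs_norm (A * X - X * B))\<^sup>2
      + (\<Sum>j=2..N. s_seq j \<nu> *
          (hs_norm (mat_powr A (of_int (k_seq j \<nu>) / 2 ^ (j - 1)) * X
                      * mat_powr B (1 - of_int (k_seq j \<nu>) / 2 ^ (j - 1))
                  - mat_powr A (of_int (k_seq j \<nu> + 1) / 2 ^ (j - 1)) * X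
                      * mat_powr B (1 - of_int (k_seq j \<nu> + 1) / 2 ^ (j - 1))))\<^sup>2)
    \<le> (hs_norm (complex_of_real \<nu> \<cdot>\<^sub>m (A * X) + complex_of_real (1 - \<nu>) \<cdot>\<^sub>m (X * B)))\<^sup>2"
proof -
  obtain U d where dA: "spectral_dec n A U d" and d: "\<And>i. i < n \<Longrightarrow> 0 \<le> d i"
    using psd_mat_spectral_dec[OF assms(1)] by blast
  obtain V e where eB: "spectral_dec n B V e" and e: "\<And>i. i < n \<Longrightarrow> 0 \<le> e i"
    using psd_mat_spectral_dec[OF assms(2)] by blast
  have U: "unitary_mat n U" and V: "unitary_mat n V"
    using dA eB by (auto simp: spectral_dec_alt)
  note cU = unitary_matD[OF U] and cV = unitary_matD[OF V] and X = assms(3)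
  define Y where "Y = mat_adjoint U * X * V"
  have Y: "Y \<in> carrier_mat n n" using cU cV X by (simp add: Y_def)
  have XY: "X = U * Y * mat_adjoint V"
    using adjoint_conj_cancel[OF unitary_mat_adjoint[OF U] unitary_mat_adjoint[OF V] X]
    by (simp add: Y_def)
  \<comment> \<open>In the eigenbases of \<open>A\<close> and \<open>B\<close>, every matrix of the statement is a Schur multiplier
    applied to \<open>Y\<close>.\<close>
  define S where "S c = mat n n (\<lambda>(i, j). complex_of_real (c i j) * Y $$ (i, j))"
    for c :: "nat \<Rightarrow> nat \<Rightarrow> real"
  define T where "T c = U * S c * mat_adjoint V" for c
  have S: "S c \<in> carrier_mat n n" and US: "U * S c \<in> carrier_mat n n" for c
    using cU by (auto simp: S_def)
  have T: "T c \<in> carrier_mat n n" for c by (simp add: T_def mult_carrier_mat[OF US cV(2)])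
  \<comment> \<open>The weights \<open>(cmod (Y $$ (i, j)))\<^sup>2\<close> are nonnegative and
    common to all terms, so it suffices to compare the coefficients for each pair
    \<open>(i, j)\<close>.\<close>
  have hs: "(hs_norm (T c))\<^sup>2 = (\<Sum>i<n. \<Sum>j<n. (c i j)\<^sup>2 * (cmod (Y $$ (i, j)))\<^sup>2)" for c
    unfolding T_def hs_norm_unitary_conj[OF U V S]
    by (simp add: hs_norm_sq S_def norm_mult power_mult_distrib)
  have add: "T c + T c' = T (\<lambda>i j. c i j + c' i j)" for c c'
  proof -
    have "S (\<lambda>i j. c i j + c' i j) = S c + S c'"
      by (intro eq_matI) (auto simp: S_def algebra_simps)
    then show ?thesis
      by (simp add: T_def mult_add_distrib_mat[OF cU(1) S S] add_mult_distrib_mat[OF US US cV(2)])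
  qed
  have smult: "complex_of_real r \<cdot>\<^sub>m T c = T (\<lambda>i j. r * c i j)" for r c
  proof -
    have "S (\<lambda>i j. r * c i j) = complex_of_real r \<cdot>\<^sub>m S c"
      by (intro eq_matI) (auto simp: S_def)
    then show ?thesis
      by (simp add: T_def mult_smult_distrib[OF cU(1) S] mult_smult_assoc_mat[OF US cV(2)])
  qed
  have diff: "T c - T c' = T (\<lambda>i j. c i j - c' i j)" for c c'
  proof -
    have "T c - T c' = T c + complex_of_real (- 1) \<cdot>\<^sub>m T c'"
      using T[of c] T[of c'] by (intro eq_matI) auto
    then show ?thesis by (simp only: smult add) simp
  qed
  have prod: "(U * mat_diag n (\<lambda>i. complex_of_real (f i)) * mat_adjoint U) * X
      * (V * mat_diag n (\<lambda>i. complex_of_real (g i)) * mat_adjoint V) = T (\<lambda>i j. f i * g j)" for f g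
  proof -
    let ?F = "mat_diag n (\<lambda>i. complex_of_real (f i))" and ?G = "mat_diag n (\<lambda>i. complex_of_real (g i))"
    have F: "?F \<in> carrier_mat n n" and G: "?G \<in> carrier_mat n n" by auto
    have "?F * Y * ?G = S (\<lambda>i j. f i * g j)"
      using Y by (intro eq_matI) (auto simp: S_def mat_diag_mult_left[OF Y] mat_diag_mult_right[of _ n n])
    moreover have "(U * ?F * mat_adjoint U) * X * (V * ?G * mat_adjoint V)
        = U * (?F * Y * ?G) * mat_adjoint V"
      using cU(1,2) cV(1,2) X F G
      by (simp add: Y_def assoc_mult_mat[of _ n n _ n _ n] mult_carrier_mat[of _ n n _ n])
    ultimately show ?thesis by (simp add: T_def)
  qed
  \<comment> \<open>This holds for every real \<open>s\<close>, hence also for the exponents beyond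
    1 that occur at \<nu> = 1.\<close>
  have pw: "mat_powr A s * X * mat_powr B (1 - s) = T (\<lambda>i j. geo_path (d i) (e j) s)" for s
    unfolding mat_powr_spectral[OF dA] mat_powr_spectral[OF eB] prod geo_path_def ..
  \<comment> \<open>The products with a single factor are instances of \<open>prod\<close> with the
    constant function 1 on the other side.\<close>
  have one: "W * mat_diag n (\<lambda>i. complex_of_real 1) * mat_adjoint W = 1\<^sub>m n" if "unitary_mat n W" for W
    using unitary_matD[OF that] by simp
  have AX: "A * X = T (\<lambda>i j. d i)"
    using prod[of d "\<lambda>_. 1", unfolded one[OF V]] dA mult_carrier_mat[of A n n X n] X cU
    by (simp add: spectral_dec_alt)
  have XB: "X * B = T (\<lambda>i j. e j)"
    using prod[of "\<lambda>_. 1" e, unfolded one[OF U]] eB X by (simp add: spectral_dec_alt)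
  have "(\<Sum>i<n. \<Sum>j<n. ((geo_path (d i) (e j) \<nu>)\<^sup>2 + (s_seq 1 \<nu>)\<^sup>2 * (d i - e j)\<^sup>2
        + (\<Sum>l=2..N. s_seq l \<nu> * (geo_path (d i) (e j) (of_int (k_seq l \<nu>) / 2 ^ (l - 1))
             - geo_path (d i) (e j) (of_int (k_seq l \<nu> + 1) / 2 ^ (l - 1)))\<^sup>2))
          * (cmod (Y $$ (i, j)))\<^sup>2)
      \<le> (\<Sum>i<n. \<Sum>j<n. (\<nu> * d i + (1 - \<nu>) * e j)\<^sup>2 * (cmod (Y $$ (i, j)))\<^sup>2)"
    using refined_young_sq[OF d e] assms by (intro sum_mono mult_right_mono) auto
  then show ?thesis
    \<comment> \<open>Both sides become weighted sums over \<open>(i, j)\<close>; the sum over the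
      levels is interchanged with them.\<close>
    unfolding pw AX XB diff smult add hs
    by (simp only: distrib_right sum.distrib sum_distrib_left sum_distrib_right mult.assoc
        sum.swap[of _ "{2..N}" "{..<n}"] sum.swap[of _ "{2..N}" "{..<n}"])
qed

end
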